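(* Let $\Bbbk$ be an algebraically closed field of characteristic $0$, and let $(R,\mathfrak{m},\Bbbk)$ be a non-regular complete Noetherian local domain of dimension one which is a $\Bbbk$-algebra (with residue field $\Bbbk$). Let $\overline{R}=\Bbbk[[t]]$ be the integral closure of $R$ in its fraction field, and let the conductor of $R$ be $\mathfrak{C}_R=t^{c_R}\overline{R}$. Write $R=\Bbbk[[\alpha_1t^{a_1},\ldots,\alpha_nt^{a_n}]]\subseteq \Bbbk[[t]]$, where $n\geq 2$, $a_1<a_2<\cdots<a_n$ are positive integers, each $\alpha_i$ is a unit of $\Bbbk[[t]]$, and $\alpha_1t^{a_1},\ldots,\alpha_nt^{a_n}$ is a minimal generating set of $\mathfrak{m}$. Let $r\in\{1,\ldots,n\}$ be an index with $$o(\alpha_r)=\min_{1\leq i\leq n}\{o(\alpha_i)\},$$ and set $$a=\min_{j\neq r}\{a_j\}.$$ If $o(\alpha_r)+a\geq c_R$, then $R$ is quasihomogeneous.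
   Context: Setting: $R$ can be written as $R=P/I$ with $P=\Bbbk[[X_1,\ldots,X_n]]$, $n\geq 2$, and $I=(f_1,\ldots,f_m)\subseteq (X_1,\ldots,X_n)^2$ a prime ideal; $x_i$ denotes the image of $X_i$ in $R$. Let $Q=\operatorname{Frac}(R)$. The integral closure $\overline{R}$ of $R$ in $Q$ is a discrete valuation ring; fix a uniformizing parameter $t$, so $\overline{R}=\Bbbk[[t]]$. Via $R\subseteq\overline{R}$ each $x_i$ is written as $x_i=\alpha_it^{a_i}$ with $\alpha_i$ a unit of $\Bbbk[[t]]$. Conductor: $\mathfrak{C}_R=R:_Q\overline{R}=\{y\in Q\mid y\overline{R}\subseteq R\}$. It is a nonzero ideal of both $R$ and $\overline{R}$, so $\mathfrak{C}_R=t^{c_R}\overline{R}$ for a unique integer $c_R$. Order valuation: for $p=\sum_{i\geq 0}c_it^i\in\Bbbk[[t]]$, $v(p)=\min\{i\mid c_i\neq 0\}$, with $v(0)=\infty$. Order valuation of units: for a unit $\alpha=\sum_{i\geq 0}c_it^i\in\Bbbk[[t]]$ ($c_0\neq 0$), $o(\alpha)=v(\alpha-c_0)=\min\{i\geq 1\mid c_i\neq 0\}$, with $o(\alpha)=\infty$ if $\alpha=c_0$ is constant. Module of differentials: $\Omega_R$ denotes the universally finite module of differentials of $R$ over $\Bbbk$, i.e. the $R$-module with presentation $$R^m\xrightarrow{\left[\frac{\partial f_j}{\partial x_i}\right]}R^n\to\Omega_R\to 0,$$ where the matrix is the Jacobian matrix of $f_1,\ldots,f_m$ with entries taken in $R$.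 Quasihomogeneous: $R$ is called quasihomogeneous if there exists a surjective $R$-module homomorphism $\Omega_R\to\mathfrak{m}$. *)

theory Defs
  imports
    "HOL-Library.Extended_Nat"
    "HOL-Library.FuncSet"
    "HOL-Library.Poly_Mapping"
    "HOL-Computational_Algebra.Computational_Algebra"
    "HOL-Algebra.Module"
    "HOL-Algebra.Ideal_Product"
    "HOL-Algebra.Ring_Divisibility"
begin

section \<open>Local rings\<close>

definition local_ring :: "('a, 'b) ring_scheme \<Rightarrow> 'a set \<Rightarrow> bool" where
  "local_ring R M \<longleftrightarrow>
     cring R \<and> maximalideal M R \<and> (\<forall>J. maximalideal J R \<longrightarrow> J = M)"

primrec ideal_power :: "('a, 'b) ring_scheme \<Rightarrow> 'a set \<Rightarrow> nat \<Rightarrow> 'a set" where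
  "ideal_power R I 0 = carrier R"
| "ideal_power R I (Suc k) = ideal_prod R (ideal_power R I k) I"

text \<open>Completeness includes separatedness, i.e. it says that \<open>R\<close> is the inverse limit
  of the rings \<open>R / I^k\<close>.\<close>

definition adically_complete :: "('a, 'b) ring_scheme \<Rightarrow> 'a set \<Rightarrow> bool" where
  "adically_complete R I \<longleftrightarrow>
     (\<Inter>k. ideal_power R I k) = {\<zero>\<^bsub>R\<^esub>} \<and>
     (\<forall>s :: nat \<Rightarrow> 'a. range s \<subseteq> carrier R \<longrightarrow>
        (\<forall>k. \<exists>N. \<forall>i\<ge>N. \<forall>j\<ge>N. s i \<ominus>\<^bsub>R\<^esub> s j \<in> ideal_power R I k) \<longrightarrow>
        (\<exists>l\<in>carrier R. \<forall>k. \<exists>N. \<forall>i\<ge>N. s i \<ominus>\<^bsub>R\<^esub> l \<in> ideal_power R I k))"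

definition krull_dim :: "('a, 'b) ring_scheme \<Rightarrow> enat" where
  "krull_dim R = Sup {enat l | l. \<exists>p :: nat \<Rightarrow> 'a set.
     (\<forall>i\<le>l. primeideal (p i) R) \<and> (\<forall>i<l. p i \<subset> p (Suc i))}"

definition regular_local_ring :: "('a, 'b) ring_scheme \<Rightarrow> 'a set \<Rightarrow> bool" where
  "regular_local_ring R M \<longleftrightarrow> local_ring R M \<and> noetherian_ring R \<and>
     (\<exists>S \<subseteq> carrier R. finite S \<and> Idl\<^bsub>R\<^esub> S = M \<and> enat (card S) = krull_dim R)"

definition minimal_generating_set :: "('a, 'b) ring_scheme \<Rightarrow> 'a set \<Rightarrow> 'a set \<Rightarrow> bool" where
  "minimal_generating_set R I S \<longleftrightarrow>
     S \<subseteq> carrier R \<and> Idl\<^bsub>R\<^esub> S = I \<and> (\<forall>T. T \<subset> S \<longrightarrow> Idl\<^bsub>R\<^esub> T \<noteq> I)"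


section \<open>Modules\<close>

text \<open>The ring multiplication and unit are unused fields of the module records below.\<close>

definition ideal_module :: "('a, 'b) ring_scheme \<Rightarrow> 'a set \<Rightarrow> ('a, 'a) module" where
  "ideal_module R I = \<lparr>carrier = I, mult = undefined, one = undefined,
     zero = \<zero>\<^bsub>R\<^esub>, add = add R, smult = mult R\<rparr>"

definition free_module :: "('a, 'b) ring_scheme \<Rightarrow> nat \<Rightarrow> ('a, nat \<Rightarrow> 'a) module" where
  "free_module R n = \<lparr>carrier = {..<n} \<rightarrow>\<^sub>E carrier R, mult = undefined, one = undefined,
     zero = (\<lambda>i\<in>{..<n}. \<zero>\<^bsub>R\<^esub>),
     add = (\<lambda>u v. \<lambda>i\<in>{..<n}. u i \<oplus>\<^bsub>R\<^esub> v i),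
     smult = (\<lambda>r v. \<lambda>i\<in>{..<n}. r \<otimes>\<^bsub>R\<^esub> v i)\<rparr>"

definition quotient_module :: "('a, 'b, 'c) module_scheme \<Rightarrow> 'b set \<Rightarrow> ('a, 'b set) module" where
  "quotient_module V N = \<lparr>carrier = a_rcosets\<^bsub>V\<^esub> N, mult = undefined, one = undefined,
     zero = N, add = set_add V,
     smult = (\<lambda>r C. \<Union>v\<in>C. N +>\<^bsub>V\<^esub> (r \<odot>\<^bsub>V\<^esub> v))\<rparr>"

definition module_hom ::
  "('a, 'b) ring_scheme \<Rightarrow> ('a, 'c, 'd) module_scheme \<Rightarrow> ('a, 'e, 'f) module_scheme \<Rightarrow> ('c \<Rightarrow> 'e) set"
  where
  "module_hom R V W = {h \<in> carrier V \<rightarrow> carrier W.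
     (\<forall>u\<in>carrier V. \<forall>v\<in>carrier V. h (u \<oplus>\<^bsub>V\<^esub> v) = h u \<oplus>\<^bsub>W\<^esub> h v) \<and>
     (\<forall>r\<in>carrier R. \<forall>v\<in>carrier V. h (r \<odot>\<^bsub>V\<^esub> v) = r \<odot>\<^bsub>W\<^esub> h v)}"

text \<open>The cokernel of the map \<open>R\<^sup>m \<rightarrow> R\<^sup>n\<close> given by an \<open>n \<times> m\<close> matrix \<open>A\<close>
  (row index first).\<close>

definition matrix_image ::
  "('a, 'b) ring_scheme \<Rightarrow> nat \<Rightarrow> nat \<Rightarrow> (nat \<Rightarrow> nat \<Rightarrow> 'a) \<Rightarrow> (nat \<Rightarrow> 'a) set" where
  "matrix_image R n m A =
     (\<lambda>u. \<lambda>i\<in>{..<n}. \<Oplus>\<^bsub>R\<^esub>j\<in>{..<m}. A i j \<otimes>\<^bsub>R\<^esub> u j) ` ({..<m} \<rightarrow>\<^sub>E carrier R)"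

definition matrix_coker ::
  "('a, 'b) ring_scheme \<Rightarrow> nat \<Rightarrow> nat \<Rightarrow> (nat \<Rightarrow> nat \<Rightarrow> 'a) \<Rightarrow> ('a, (nat \<Rightarrow> 'a) set) module" where
  "matrix_coker R n m A = quotient_module (free_module R n) (matrix_image R n m A)"


section \<open>Power series in several variables\<close>

text \<open>A power series in \<open>X\<^sub>0, \<dots>, X\<^sub>n\<^sub>-\<^sub>1\<close> is its coefficient function on
  exponent vectors; those lying outside the first \<open>n\<close> positions get coefficient \<open>0\<close>.\<close>

type_synonym 'k mfps = "(nat \<Rightarrow>\<^sub>0 nat) \<Rightarrow> 'k"

definition mfps_ring :: "nat \<Rightarrow> 'k::comm_ring_1 mfps ring" where
  "mfps_ring n = \<lparr>carrier = {F. \<forall>e. F e \<noteq> 0 \<longrightarrow> Poly_Mapping.keys e \<subseteq> {..<n}},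
     mult = (\<lambda>F G e. \<Sum>(d, d')\<in>{(d, d'). d + d' = e}. F d * G d'),
     one = (\<lambda>e. if e = 0 then 1 else 0),
     zero = (\<lambda>_. 0),
     add = (\<lambda>F G e. F e + G e)\<rparr>"

definition mfps_var :: "nat \<Rightarrow> 'k::comm_ring_1 mfps" where
  "mfps_var i = (\<lambda>e. if e = Poly_Mapping.single i 1 then 1 else 0)"

definition mfps_deriv :: "nat \<Rightarrow> 'k::comm_ring_1 mfps \<Rightarrow> 'k mfps" where
  "mfps_deriv i F = (\<lambda>e. of_nat (Suc (Poly_Mapping.lookup e i)) * F (e + Poly_Mapping.single i 1))"

text \<open>Substitution \<open>X\<^sub>i \<mapsto> x\<^sub>i\<close>, meant for \<open>x\<^sub>i\<close> without constant term:
  a monomial of degree greater than \<open>N\<close> then contributes nothing to the coefficient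
  of \<open>t\<^sup>N\<close>, so that the sum below is the full (infinite) one.\<close>

definition mfps_eval :: "nat \<Rightarrow> (nat \<Rightarrow> 'k::comm_ring_1 fps) \<Rightarrow> 'k mfps \<Rightarrow> 'k fps" where
  "mfps_eval n x F = Abs_fps (\<lambda>N.
     \<Sum>e | Poly_Mapping.keys e \<subseteq> {..<n} \<and> (\<Sum>i<n. Poly_Mapping.lookup e i) \<le> N.
       F e * fps_nth (\<Prod>i<n. x i ^ Poly_Mapping.lookup e i) N)"


section \<open>Subrings of a power series ring in one variable\<close>

text \<open>The Laurent series field \<open>'k fls\<close> serves as an ambient field for \<open>Frac(R)\<close>
  and the integral closure of \<open>R\<close>.\<close>

definition fps_ring :: "'k::comm_ring_1 fps set \<Rightarrow> 'k fps ring" where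
  "fps_ring R = \<lparr>carrier = R, mult = (*), one = 1, zero = 0, add = (+)\<rparr>"

definition frac_field :: "'k::field fps set \<Rightarrow> 'k fls set" where
  "frac_field R = {fps_to_fls p / fps_to_fls q | p q. p \<in> R \<and> q \<in> R \<and> q \<noteq> 0}"

definition integral_closure :: "'k::field fps set \<Rightarrow> 'k fls set" where
  "integral_closure R = {y \<in> frac_field R. \<exists>p :: 'k fls poly.
     lead_coeff p = 1 \<and> (\<forall>i. Polynomial.coeff p i \<in> fps_to_fls ` R) \<and> poly p y = 0}"

definition conductor :: "'k::field fps set \<Rightarrow> 'k fls set" where
  "conductor R = {y \<in> frac_field R. \<forall>z\<in>integral_closure R. y * z \<in> fps_to_fls ` R}"

definition fps_val :: "'k::zero fps \<Rightarrow> enat" where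
  "fps_val p = (if p = 0 then \<infinity> else enat (subdegree p))"

definition unit_order :: "'k::comm_ring_1 fps \<Rightarrow> enat" where
  "unit_order \<alpha> = fps_val (\<alpha> - fps_const (fps_nth \<alpha> 0))"


section \<open>Differentials\<close>

text \<open>The universally finite module of differentials of \<open>R = k[[x\<^sub>0, \<dots>, x\<^sub>n\<^sub>-\<^sub>1]]\<close>, presented by
  the Jacobian matrix of generators \<open>f\<^sub>0, \<dots>, f\<^sub>m\<^sub>-\<^sub>1\<close> of the ideal of relations of \<open>x\<close>.\<close>

definition differentials ::
  "'k::comm_ring_1 fps set \<Rightarrow> nat \<Rightarrow> (nat \<Rightarrow> 'k fps) \<Rightarrow> nat \<Rightarrow> (nat \<Rightarrow> 'k mfps) \<Rightarrow>
     ('k fps, (nat \<Rightarrow> 'k fps) set) module" where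
  "differentials R n x m f =
     matrix_coker (fps_ring R) n m (\<lambda>i j. mfps_eval n x (mfps_deriv i (f j)))"

definition quasihomogeneous ::
  "('a, 'b) ring_scheme \<Rightarrow> 'a set \<Rightarrow> ('a, 'c, 'd) module_scheme \<Rightarrow> bool" where
  "quasihomogeneous R M \<Omega> \<longleftrightarrow>
     (\<exists>h \<in> module_hom R \<Omega> (ideal_module R M). h ` carrier \<Omega> = M)"

end

theory Submission
  imports Defs
begin

text \<open>Take the derivation \<open>D = g d/dt\<close> with \<open>g = a\<^sub>r x\<^sub>r / x\<^sub>r'\<close>, so that \<open>D x\<^sub>r = a\<^sub>r x\<^sub>r\<close>. For
  \<open>i \<noteq> r\<close>, \<open>D x\<^sub>i - a\<^sub>i x\<^sub>i\<close> has order at least \<open>a\<^sub>i + o(\<alpha>\<^sub>r) \<ge> c\<close>, hence lies in the conductor. So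
  \<open>D\<close> maps \<open>R\<close> to itself and induces a homomorphism from the module of differentials to the
  maximal ideal \<open>M\<close> sending the \<open>i\<close>-th generator to \<open>D x\<^sub>i\<close>; by the chain rule its image contains
  \<open>D(R)\<close>. On leading terms \<open>D\<close> multiplies \<open>t\<^sup>k\<close> by a nonzero multiple of \<open>k\<close>, and \<open>R\<close> contains
  all series of order at least \<open>c\<close>, so descending induction on the order gives \<open>D(R) = M\<close>.\<close>

section \<open>Substitution and the chain rule\<close>

text \<open>The index set of the sum in \<open>mfps_eval\<close>, with the degree bound as a
  parameter so that one truncation can serve several coefficients.\<close>

definition exponents :: "nat \<Rightarrow> nat \<Rightarrow> (nat \<Rightarrow>\<^sub>0 nat) set" where
  "exponents n N = {e. Poly_Mapping.keys e \<subseteq> {..<n} \<and> (\<Sum>i<n. Poly_Mapping.lookup e i) \<le> N}"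

definition monom_eval :: "nat \<Rightarrow> (nat \<Rightarrow> 'k::comm_ring_1 fps) \<Rightarrow> (nat \<Rightarrow>\<^sub>0 nat) \<Rightarrow> 'k fps" where
  "monom_eval n x e = (\<Prod>i<n. x i ^ Poly_Mapping.lookup e i)"

text \<open>An exponent vector here is a function supported on \<open>{..<n}\<close> with entries at
  most \<open>N\<close>, and there are finitely many of those.\<close>

lemma finite_exponents: "finite (exponents n N)"
proof -
  have "inj_on Poly_Mapping.lookup (exponents n N)"
    by (auto intro!: inj_onI simp: poly_mapping_eqI)
  moreover have "Poly_Mapping.lookup ` exponents n N \<subseteq>
      {g. \<forall>i. (i \<in> {..<n} \<longrightarrow> g i \<in> {..N}) \<and> (i \<notin> {..<n} \<longrightarrow> g i = 0)}"
  proof (intro image_subsetI CollectI allI conjI impI)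
    fix e i assume e: "e \<in> exponents n N" and "i \<in> {..<n}"
    then have "Poly_Mapping.lookup e i \<le> (\<Sum>i<n. Poly_Mapping.lookup e i)"
      by (intro member_le_sum) auto
    with e show "Poly_Mapping.lookup e i \<in> {..N}" by (simp add: exponents_def)
  qed (auto simp: exponents_def in_keys_iff)
  then have "finite (Poly_Mapping.lookup ` exponents n N)"
    by (rule finite_subset) (intro finite_set_of_finite_funs finite_lessThan finite_atMost)
  ultimately show ?thesis by (rule finite_imageD[rotated])
qed

text \<open>Each \<open>x i\<close> is divisible by \<open>fps_X\<close>, so a monomial of degree d
  takes a value divisible by \<open>fps_X ^ d\<close>.\<close>

lemma monom_eval_nth_eq_0:
  fixes x :: "nat \<Rightarrow> 'k::comm_ring_1 fps"
  assumes x: "\<And>i. i < n \<Longrightarrow> fps_nth (x i) 0 = 0"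
    and N: "N < (\<Sum>i<n. Poly_Mapping.lookup e i)"
  shows "fps_nth (monom_eval n x e) N = 0"
proof -
  have "x i = fps_X * fps_shift 1 (x i)" if "i < n" for i
    using x[OF that] by (intro fps_ext) auto
  then have "monom_eval n x e =
      (\<Prod>i<n. fps_X ^ Poly_Mapping.lookup e i * fps_shift 1 (x i) ^ Poly_Mapping.lookup e i)"
    unfolding monom_eval_def by (metis (no_types, lifting) lessThan_iff power_mult_distrib prod.cong)
  also have "\<dots> = fps_X ^ (\<Sum>i<n. Poly_Mapping.lookup e i) *
      (\<Prod>i<n. fps_shift 1 (x i) ^ Poly_Mapping.lookup e i)"
    by (simp add: prod.distrib power_sum)
  finally show ?thesis using N by (simp add: fps_X_power_mult_nth)
qed

text \<open>Monomials of degree above \<open>N\<close> do not reach the coefficient of index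
  \<open>N\<close>, so any larger cutoff \<open>K\<close> gives the same value. Coefficients of an
  infinite substitution can thus be read off a finite sum, which can be differentiated
  termwise.\<close>

lemma mfps_eval_nth:
  fixes x :: "nat \<Rightarrow> 'k::comm_ring_1 fps"
  assumes x: "\<And>i. i < n \<Longrightarrow> fps_nth (x i) 0 = 0" and N: "N \<le> K"
  shows "fps_nth (mfps_eval n x F) N =
    fps_nth (\<Sum>e\<in>exponents n K. fps_const (F e) * monom_eval n x e) N"
proof -
  have "fps_nth (mfps_eval n x F) N = (\<Sum>e\<in>exponents n N. F e * fps_nth (monom_eval n x e) N)"
    by (simp add: mfps_eval_def exponents_def monom_eval_def)
  also have "\<dots> = (\<Sum>e\<in>exponents n K. F e * fps_nth (monom_eval n x e) N)"
  proof (intro sum.mono_neutral_left finite_exponents ballI)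
    show "exponents n N \<subseteq> exponents n K" using N by (auto simp: exponents_def)
    fix e assume "e \<in> exponents n K - exponents n N"
    then have "N < (\<Sum>i<n. Poly_Mapping.lookup e i)" by (auto simp: exponents_def)
    then show "F e * fps_nth (monom_eval n x e) N = 0" by (simp add: monom_eval_nth_eq_0 x)
  qed
  finally show ?thesis by (simp add: fps_sum_nth)
qed

lemma fps_deriv_prod:
  fixes f :: "'a \<Rightarrow> 'k::comm_ring_1 fps"
  assumes "finite A"
  shows "fps_deriv (prod f A) = (\<Sum>i\<in>A. fps_deriv (f i) * prod f (A - {i}))"
  using assms
proof induction
  case (insert a A)
  have "fps_deriv (f i) * prod f (insert a A - {i}) = f a * (fps_deriv (f i) * prod f (A - {i}))"
    if "i \<in> A" for i
  proof -
    have "insert a A - {i} = insert a (A - {i})" using insert that by auto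
    then show ?thesis using insert by (simp add: ac_simps)
  qed
  with insert show ?case by (simp add: sum_distrib_left ac_simps)
qed simp

lemma monom_eval_add_single:
  assumes "i < n"
  shows "monom_eval n x (d + Poly_Mapping.single i 1) = monom_eval n x d * x i"
proof -
  have "monom_eval n x (d + Poly_Mapping.single i 1) =
      (\<Prod>j<n. x j ^ Poly_Mapping.lookup d j * (if j = i then x j else 1))"
    unfolding monom_eval_def
    by (intro prod.cong) (auto simp: lookup_add lookup_single when_def)
  also have "\<dots> = monom_eval n x d * x i"
    using assms by (simp add: monom_eval_def prod.distrib prod.delta)
  finally show ?thesis .
qed

text \<open>The Leibniz rule. The truncated difference \<open>e - Poly_Mapping.single i 1\<close> is
  harmless: when the exponent of variable \<open>i\<close> is 0, the numerical factor kills the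
  term.\<close>

lemma fps_deriv_monom_eval:
  fixes x :: "nat \<Rightarrow> 'k::comm_ring_1 fps"
  shows "fps_deriv (monom_eval n x e) =
    (\<Sum>i<n. of_nat (Poly_Mapping.lookup e i) *
       monom_eval n x (e - Poly_Mapping.single i 1) * fps_deriv (x i))"
proof -
  have "fps_deriv (x i ^ Poly_Mapping.lookup e i) *
        (\<Prod>j\<in>{..<n} - {i}. x j ^ Poly_Mapping.lookup e j) =
      of_nat (Poly_Mapping.lookup e i) *
        monom_eval n x (e - Poly_Mapping.single i 1) * fps_deriv (x i)" if "i < n" for i
  proof -
    have "monom_eval n x (e - Poly_Mapping.single i 1) =
        x i ^ (Poly_Mapping.lookup e i - 1) * (\<Prod>j\<in>{..<n} - {i}. x j ^ Poly_Mapping.lookup e j)"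
      unfolding monom_eval_def using that
      by (subst prod.remove[of _ i])
        (auto intro!: prod.cong arg_cong2[where f = "(*)"]
          simp: lookup_minus lookup_single when_def)
    then show ?thesis by (simp add: fps_deriv_power fps_of_nat ac_simps)
  qed
  then show ?thesis by (simp add: monom_eval_def[of n x e] fps_deriv_prod)
qed

text \<open>Reindexing behind termwise differentiation: only monomials divisible by variable
  \<open>i\<close> contribute, and dividing by that variable lowers the degree by one, hence the
  change of cutoff.\<close>

lemma sum_exponents_Suc:
  fixes G :: "(nat \<Rightarrow>\<^sub>0 nat) \<Rightarrow> 'k::comm_ring_1"
  assumes i: "i < n" and G: "\<And>e. Poly_Mapping.lookup e i = 0 \<Longrightarrow> G e = 0"
  shows "(\<Sum>e\<in>exponents n (Suc N). G e) = (\<Sum>d\<in>exponents n N. G (d + Poly_Mapping.single i 1))"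
proof -
  let ?S = "{e \<in> exponents n (Suc N). Poly_Mapping.lookup e i \<noteq> 0}"
  have cancel: "e - Poly_Mapping.single i 1 + Poly_Mapping.single i 1 = e"
    if "Poly_Mapping.lookup e i \<noteq> 0" for e :: "nat \<Rightarrow>\<^sub>0 nat"
    using that by (intro poly_mapping_eqI) (auto simp: lookup_add lookup_minus lookup_single when_def)
  have keys: "Poly_Mapping.keys (d + Poly_Mapping.single i 1) \<subseteq> {..<n} \<longleftrightarrow>
      Poly_Mapping.keys d \<subseteq> {..<n}" for d :: "nat \<Rightarrow>\<^sub>0 nat"
    using i by (auto simp: in_keys_iff lookup_add lookup_single when_def subset_iff)
  have deg: "(\<Sum>j<n. Poly_Mapping.lookup (d + Poly_Mapping.single i 1) j) =
      Suc (\<Sum>j<n. Poly_Mapping.lookup d j)" for d :: "nat \<Rightarrow>\<^sub>0 nat"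
    using i by (simp add: lookup_add lookup_single when_def sum.distrib sum.delta)
  have shift: "d + Poly_Mapping.single i 1 \<in> exponents n (Suc N) \<longleftrightarrow> d \<in> exponents n N" for d
    unfolding exponents_def by (simp only: mem_Collect_eq keys deg Suc_le_mono)
  have "(\<Sum>e\<in>exponents n (Suc N). G e) = (\<Sum>e\<in>?S. G e)"
    by (intro sum.mono_neutral_right finite_exponents) (auto simp: G)
  also have "\<dots> = (\<Sum>d\<in>exponents n N. G (d + Poly_Mapping.single i 1))"
  proof (rule sum.reindex_bij_witness[where
        i = "\<lambda>d. d + Poly_Mapping.single i 1" and j = "\<lambda>e. e - Poly_Mapping.single i 1"])
    fix e assume "e \<in> ?S"
    then have e: "e \<in> exponents n (Suc N)" "Poly_Mapping.lookup e i \<noteq> 0" by auto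
    show "e - Poly_Mapping.single i 1 + Poly_Mapping.single i 1 = e"
      "G (e - Poly_Mapping.single i 1 + Poly_Mapping.single i 1) = G e"
      by (simp_all only: cancel[OF e(2)])
    show "e - Poly_Mapping.single i 1 \<in> exponents n N"
      using e(1) shift[of "e - Poly_Mapping.single i 1"] unfolding cancel[OF e(2)] by simp
  next
    fix d assume d: "d \<in> exponents n N"
    show "d + Poly_Mapping.single i 1 - Poly_Mapping.single i 1 = d" by simp
    show "d + Poly_Mapping.single i 1 \<in> ?S"
      using d shift[of d] by (simp add: lookup_add)
  qed
  finally show ?thesis .
qed

lemma fps_nth_mult_cong:
  fixes p q s :: "'k::comm_ring_1 fps"
  assumes "\<And>k. k \<le> N \<Longrightarrow> fps_nth p k = fps_nth q k"
  shows "fps_nth (p * s) N = fps_nth (q * s) N"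
  using assms by (simp add: fps_mult_nth)

text \<open>The chain rule, checked coefficientwise on truncations. Coefficient \<open>N\<close> of
  the derivative needs coefficient \<open>Suc N\<close> of the series, so the cutoff starts at
  \<open>Suc N\<close>; reindexing brings it back to \<open>N\<close>, as the substituted partial
  derivatives require.\<close>

lemma fps_deriv_mfps_eval:
  fixes x :: "nat \<Rightarrow> 'k::comm_ring_1 fps"
  assumes x: "\<And>i. i < n \<Longrightarrow> fps_nth (x i) 0 = 0"
  shows "fps_deriv (mfps_eval n x F) = (\<Sum>i<n. mfps_eval n x (mfps_deriv i F) * fps_deriv (x i))"
proof (rule fps_ext)
  fix N
  \<comment> \<open>The share of monomial \<open>e\<close> and variable \<open>i\<close> in
    coefficient \<open>N\<close>.\<close>
  define T where "T i e = F e * (of_nat (Poly_Mapping.lookup e i) *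
      fps_nth (monom_eval n x (e - Poly_Mapping.single i 1) * fps_deriv (x i)) N)" for i e
  have "fps_nth (fps_deriv (mfps_eval n x F)) N =
      fps_nth (fps_deriv (\<Sum>e\<in>exponents n (Suc N). fps_const (F e) * monom_eval n x e)) N"
    by (simp add: mfps_eval_nth[OF x order_refl])
  also have "\<dots> = (\<Sum>e\<in>exponents n (Suc N). F e * fps_nth (fps_deriv (monom_eval n x e)) N)"
    by (simp add: fps_deriv_sum fps_sum_nth del: fps_deriv_nth)
  also have "\<dots> = (\<Sum>e\<in>exponents n (Suc N). \<Sum>i<n. T i e)"
    by (simp add: fps_deriv_monom_eval fps_sum_nth sum_distrib_left T_def mult.assoc
        fps_of_nat[symmetric] del: fps_deriv_nth)
  also have "\<dots> = (\<Sum>i<n. \<Sum>e\<in>exponents n (Suc N). T i e)" by (rule sum.swap)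
  also have "\<dots> = (\<Sum>i<n. \<Sum>d\<in>exponents n N. T i (d + Poly_Mapping.single i 1))"
    by (intro sum.cong refl sum_exponents_Suc) (auto simp: T_def)
  also have "\<dots> = (\<Sum>i<n. fps_nth (mfps_eval n x (mfps_deriv i F) * fps_deriv (x i)) N)"
  proof (intro sum.cong refl)
    fix i
    \<comment> \<open>Coefficient \<open>N\<close> of a product sees the left factor only up to
      index \<open>N\<close>, so that factor may be truncated there.\<close>
    have "fps_nth (mfps_eval n x (mfps_deriv i F) * fps_deriv (x i)) N =
        fps_nth ((\<Sum>e\<in>exponents n N. fps_const (mfps_deriv i F e) * monom_eval n x e)
          * fps_deriv (x i)) N"
      by (intro fps_nth_mult_cong mfps_eval_nth x)
    also have "\<dots> = (\<Sum>d\<in>exponents n N. T i (d + Poly_Mapping.single i 1))"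
      unfolding sum_distrib_right fps_sum_nth mult.assoc[where 'a = "'k fps"] fps_mult_left_const_nth
      by (intro sum.cong refl) (simp add: T_def mfps_deriv_def lookup_add ac_simps)
    finally show "(\<Sum>d\<in>exponents n N. T i (d + Poly_Mapping.single i 1)) =
        fps_nth (mfps_eval n x (mfps_deriv i F) * fps_deriv (x i)) N" ..
  qed
  finally show "fps_nth (fps_deriv (mfps_eval n x F)) N =
      fps_nth (\<Sum>i<n. mfps_eval n x (mfps_deriv i F) * fps_deriv (x i)) N"
    by (simp add: fps_sum_nth)
qed

lemma mfps_deriv_closed:
  assumes "F \<in> carrier (mfps_ring n)"
  shows "mfps_deriv i F \<in> carrier (mfps_ring n)"
proof -
  have "Poly_Mapping.keys e \<subseteq> {..<n}" if "F (e + Poly_Mapping.single i 1) \<noteq> 0" for e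
  proof -
    have "Poly_Mapping.keys (e + Poly_Mapping.single i 1) \<subseteq> {..<n}"
      using that assms by (simp add: mfps_ring_def)
    then show ?thesis by (auto simp: subset_iff in_keys_iff lookup_add)
  qed
  then have "mfps_deriv i F e \<noteq> 0 \<Longrightarrow> Poly_Mapping.keys e \<subseteq> {..<n}" for e
    unfolding mfps_deriv_def by (metis mult_zero_right)
  then show ?thesis by (simp add: mfps_ring_def)
qed


section \<open>The module of differentials\<close>

lemma fps_ring_simps [simp]:
  "carrier (fps_ring R) = R" "mult (fps_ring R) = (*)" "one (fps_ring R) = 1"
  "zero (fps_ring R) = 0" "add (fps_ring R) = (+)"
  by (simp_all add: fps_ring_def)

lemma finsum_fps_ring:
  assumes "ring (fps_ring R)" "finite A" "g ` A \<subseteq> R"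
  shows "finsum (fps_ring R) g A = sum g A"
proof -
  interpret ring "fps_ring R" by fact
  show ?thesis using assms(2,3)
  proof induction
    case (insert a A)
    then have "finsum (fps_ring R) g (insert a A) = g a \<oplus>\<^bsub>fps_ring R\<^esub> finsum (fps_ring R) g A"
      by (intro finsum_insert) (auto simp del: fps_ring_simps simp: fps_ring_simps(1))
    with insert show ?case by simp
  qed (metis finsum_empty fps_ring_simps(4) sum.empty)
qed

text \<open>Since \<open>\<phi>\<close> kills \<open>N\<close>, it is constant on every coset, and
  cosets are nonempty because \<open>N\<close> is; so evaluation at a chosen representative is well
  defined.\<close>

lemma quotient_module_hom_exists:
  assumes \<phi>: "\<phi> \<in> module_hom R V W"
    and N: "N \<subseteq> carrier V" "N \<noteq> {}" "\<And>u. u \<in> N \<Longrightarrow> \<phi> u = \<zero>\<^bsub>W\<^esub>"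
    and V: "\<And>r v. r \<in> carrier R \<Longrightarrow> v \<in> carrier V \<Longrightarrow> r \<odot>\<^bsub>V\<^esub> v \<in> carrier V"
      "\<And>u v. u \<in> carrier V \<Longrightarrow> v \<in> carrier V \<Longrightarrow> u \<oplus>\<^bsub>V\<^esub> v \<in> carrier V"
    and W: "\<And>w. w \<in> carrier W \<Longrightarrow> \<zero>\<^bsub>W\<^esub> \<oplus>\<^bsub>W\<^esub> w = w"
  shows "\<exists>h \<in> module_hom R (quotient_module V N) W.
    h ` carrier (quotient_module V N) = \<phi> ` carrier V"
proof -
  define h where "h C = \<phi> (SOME v. v \<in> C)" for C
  have h: "h C = w" if "C \<noteq> {}" "\<And>v. v \<in> C \<Longrightarrow> \<phi> v = w" for C w
    unfolding h_def using that by (simp add: some_in_eq)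
  have \<phi>_add: "\<phi> (u \<oplus>\<^bsub>V\<^esub> v) = \<phi> u \<oplus>\<^bsub>W\<^esub> \<phi> v" if "u \<in> carrier V" "v \<in> carrier V" for u v
    using \<phi> that by (simp add: module_hom_def)
  have \<phi>_smult: "\<phi> (r \<odot>\<^bsub>V\<^esub> v) = r \<odot>\<^bsub>W\<^esub> \<phi> v" if "r \<in> carrier R" "v \<in> carrier V" for r v
    using \<phi> that by (simp add: module_hom_def)
  have \<phi>_closed: "\<phi> v \<in> carrier W" if "v \<in> carrier V" for v
    using \<phi> that by (auto simp: module_hom_def)
  have coset: "N +>\<^bsub>V\<^esub> v = {u \<oplus>\<^bsub>V\<^esub> v | u. u \<in> N}" for v
    by (auto simp: a_r_coset_def r_coset_def)
  have \<phi>_coset: "\<phi> w = \<phi> v" "w \<in> carrier V" if "v \<in> carrier V" "w \<in> N +>\<^bsub>V\<^esub> v" for v w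
    using that N V \<phi>_add W \<phi>_closed by (auto simp: coset subset_iff)
  have coset_nonempty: "N +>\<^bsub>V\<^esub> v \<noteq> {}" for v using N by (auto simp: coset)
  have h_coset: "h (N +>\<^bsub>V\<^esub> v) = \<phi> v" if "v \<in> carrier V" for v
    using that \<phi>_coset coset_nonempty by (intro h) auto
  have carrier: "carrier (quotient_module V N) = (\<lambda>v. N +>\<^bsub>V\<^esub> v) ` carrier V"
    by (auto simp: quotient_module_def A_RCOSETS_def RCOSETS_def a_r_coset_def)
  show ?thesis
  proof
    show "h ` carrier (quotient_module V N) = \<phi> ` carrier V"
      by (force simp: carrier h_coset)
    show "h \<in> module_hom R (quotient_module V N) W"
      unfolding module_hom_def
    proof (safe)
      fix C assume "C \<in> carrier (quotient_module V N)"
      then show "h C \<in> carrier W" by (auto simp: carrier h_coset \<phi>_closed)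
    next
      fix C D assume "C \<in> carrier (quotient_module V N)" "D \<in> carrier (quotient_module V N)"
      then obtain u v where C: "C = N +>\<^bsub>V\<^esub> u" "u \<in> carrier V" and D: "D = N +>\<^bsub>V\<^esub> v" "v \<in> carrier V"
        by (auto simp: carrier)
      have CD: "C \<oplus>\<^bsub>quotient_module V N\<^esub> D = {c \<oplus>\<^bsub>V\<^esub> d | c d. c \<in> C \<and> d \<in> D}"
        by (auto simp: quotient_module_def set_add_def set_mult_def)
      \<comment> \<open>It suffices that \<open>\<phi>\<close> is constant on this nonempty set; the
        set is never identified as a coset.\<close>
      have "h (C \<oplus>\<^bsub>quotient_module V N\<^esub> D) = \<phi> u \<oplus>\<^bsub>W\<^esub> \<phi> v"
      proof (rule h)
        obtain c d where "c \<in> C" "d \<in> D" using coset_nonempty C(1) D(1) by blast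
        then show "C \<oplus>\<^bsub>quotient_module V N\<^esub> D \<noteq> {}" unfolding CD by blast
        fix w assume "w \<in> C \<oplus>\<^bsub>quotient_module V N\<^esub> D"
        then obtain c d where w: "w = c \<oplus>\<^bsub>V\<^esub> d" "c \<in> C" "d \<in> D" unfolding CD by blast
        then show "\<phi> w = \<phi> u \<oplus>\<^bsub>W\<^esub> \<phi> v"
          using \<phi>_coset[OF C(2), of c] \<phi>_coset[OF D(2), of d] by (simp add: C D \<phi>_add)
      qed
      then show "h (C \<oplus>\<^bsub>quotient_module V N\<^esub> D) = h C \<oplus>\<^bsub>W\<^esub> h D" by (simp add: C D h_coset)
    next
      fix r C assume r: "r \<in> carrier R" and "C \<in> carrier (quotient_module V N)"
      then obtain v where C: "C = N +>\<^bsub>V\<^esub> v" "v \<in> carrier V" by (auto simp: carrier)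
      have rC: "r \<odot>\<^bsub>quotient_module V N\<^esub> C = (\<Union>u\<in>C. N +>\<^bsub>V\<^esub> (r \<odot>\<^bsub>V\<^esub> u))"
        by (simp add: quotient_module_def)
      \<comment> \<open>The scalar multiple is a union of cosets over all representatives, and
        \<open>\<phi>\<close> takes the same value on each of them.\<close>
      have "h (r \<odot>\<^bsub>quotient_module V N\<^esub> C) = r \<odot>\<^bsub>W\<^esub> \<phi> v"
      proof (rule h)
        obtain u where u: "u \<in> C" using coset_nonempty C(1) by blast
        obtain w where "w \<in> N +>\<^bsub>V\<^esub> (r \<odot>\<^bsub>V\<^esub> u)" using coset_nonempty by blast
        with u show "r \<odot>\<^bsub>quotient_module V N\<^esub> C \<noteq> {}" unfolding rC by blast
        fix w assume "w \<in> r \<odot>\<^bsub>quotient_module V N\<^esub> C"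
        then obtain u where "u \<in> C" "w \<in> N +>\<^bsub>V\<^esub> (r \<odot>\<^bsub>V\<^esub> u)" unfolding rC by blast
        then show "\<phi> w = r \<odot>\<^bsub>W\<^esub> \<phi> v"
          using r \<phi>_coset[OF C(2), of u] \<phi>_coset[OF V(1), of r u w] by (simp add: C \<phi>_smult)
      qed
      then show "h (r \<odot>\<^bsub>quotient_module V N\<^esub> C) = r \<odot>\<^bsub>W\<^esub> h C" by (simp add: C h_coset)
    qed
  qed
qed

text \<open>A homomorphism out of a cokernel amounts to images \<open>y i\<close> of the generators
  that satisfy the relation given by each column of \<open>A\<close>.\<close>

lemma matrix_coker_hom_exists:
  fixes R :: "'k::comm_ring_1 fps set"
  assumes R: "ring (fps_ring R)"
    and A: "\<And>i j. i < n \<Longrightarrow> j < m \<Longrightarrow> A i j \<in> R"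
    and M: "\<And>v. v \<in> {..<n} \<rightarrow>\<^sub>E R \<Longrightarrow> (\<Sum>i<n. v i * y i) \<in> M"
    and rel: "\<And>j. j < m \<Longrightarrow> (\<Sum>i<n. A i j * y i) = 0"
  shows "\<exists>h \<in> module_hom (fps_ring R) (matrix_coker (fps_ring R) n m A) (ideal_module (fps_ring R) M).
    h ` carrier (matrix_coker (fps_ring R) n m A) = (\<lambda>v. \<Sum>i<n. v i * y i) ` ({..<n} \<rightarrow>\<^sub>E R)"
proof -
  interpret ring "fps_ring R" by fact
  have add_closed: "p + q \<in> R" and mult_closed: "p * q \<in> R" if "p \<in> R" "q \<in> R" for p q
    using that add.m_closed[of p q] m_closed[of p q] by simp_all
  have zero: "0 \<in> R" using zero_closed by simp
  define V where "V = free_module (fps_ring R) n"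
  define \<phi> where "\<phi> v = (\<Sum>i<n. v i * y i)" for v :: "nat \<Rightarrow> 'k fps"
  have V: "carrier V = {..<n} \<rightarrow>\<^sub>E R"
    "add V = (\<lambda>u v. \<lambda>i\<in>{..<n}. u i + v i)" "smult V = (\<lambda>r v. \<lambda>i\<in>{..<n}. r * v i)"
    by (simp_all add: V_def free_module_def)
  have image: "matrix_image (fps_ring R) n m A =
      (\<lambda>u. \<lambda>i\<in>{..<n}. \<Sum>j<m. A i j * u j) ` ({..<m} \<rightarrow>\<^sub>E R)"
    unfolding matrix_image_def
    by (intro image_cong refl restrict_ext)
      (auto intro!: finsum_fps_ring[OF R] mult_closed A simp: PiE_mem)
  have sum_closed: "sum g B \<in> R" if "finite B" "\<And>b. b \<in> B \<Longrightarrow> g b \<in> R" for g :: "nat \<Rightarrow> 'k fps" and B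
    using that by (induction B rule: finite_induct) (auto intro: add_closed zero)
  show ?thesis
    unfolding matrix_coker_def V_def[symmetric] V(1)[symmetric] \<phi>_def[symmetric]
  proof (rule quotient_module_hom_exists)
    show "\<phi> \<in> module_hom (fps_ring R) V (ideal_module (fps_ring R) M)"
      using M by (auto simp: module_hom_def ideal_module_def V \<phi>_def sum.distrib sum_distrib_left
          algebra_simps)
    show "matrix_image (fps_ring R) n m A \<subseteq> carrier V"
      unfolding image V
      by (intro image_subsetI restrict_PiE_iff[THEN iffD2] ballI sum_closed mult_closed A)
        (auto simp: PiE_mem)
    show "matrix_image (fps_ring R) n m A \<noteq> {}"
      using zero by (simp add: image PiE_eq_empty_iff) blast
    show "\<phi> u = \<zero>\<^bsub>ideal_module (fps_ring R) M\<^esub>" if "u \<in> matrix_image (fps_ring R) n m A" for u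
    proof -
      from that obtain w where u: "u = (\<lambda>i\<in>{..<n}. \<Sum>j<m. A i j * w j)" unfolding image by blast
      have "\<phi> u = (\<Sum>i<n. \<Sum>j<m. w j * (A i j * y i))"
        by (simp add: \<phi>_def u sum_distrib_left sum_distrib_right ac_simps)
      \<comment> \<open>After the interchange each column relation appears as an inner sum.\<close>
      also have "\<dots> = (\<Sum>j<m. w j * (\<Sum>i<n. A i j * y i))"
        by (subst sum.swap) (simp add: sum_distrib_left)
      also have "\<dots> = 0" by (simp add: rel)
      finally show ?thesis by (simp add: ideal_module_def)
    qed
  qed (auto simp: V ideal_module_def intro!: add_closed mult_closed)
qed


section \<open>Derivations of the power series ring\<close>

text \<open>On lowest terms the operator multiplies the coefficient at index k by k times the
  constant term of \<gamma>, which is nonzero for k > 0 in characteristic 0. So the lowest term of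
  \<open>w\<close> can be cancelled by the image of a multiple of \<open>w\<close> itself, which
  lies in \<open>R\<close>. Finitely many cancellations leave a series of order above
  \<open>c\<close>, and this is handled by integration.\<close>

lemma logarithmic_derivation_onto:
  fixes \<gamma> :: "'k::field_char_0 fps"
  assumes add: "\<And>p q. p \<in> R \<Longrightarrow> q \<in> R \<Longrightarrow> p + q \<in> R"
    and scale: "\<And>b p. p \<in> R \<Longrightarrow> fps_const b * p \<in> R"
    and conductor: "\<And>p. (\<And>j. j < c \<Longrightarrow> fps_nth p j = 0) \<Longrightarrow> p \<in> R"
    and deriv: "\<And>p. p \<in> R \<Longrightarrow> fps_X * \<gamma> * fps_deriv p \<in> R"
    and \<gamma>: "fps_nth \<gamma> 0 \<noteq> 0"
    and w: "w \<in> R" "fps_nth w 0 = 0"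
  shows "\<exists>z\<in>R. fps_X * \<gamma> * fps_deriv z = w"
proof -
  \<comment> \<open>Downward induction on a lower bound \<open>k\<close> for the order. Starting at
    \<open>Suc c\<close> rather than \<open>c\<close> keeps the final value \<open>k = 1\<close> in
    range when \<open>c = 0\<close>.\<close>
  have *: "\<exists>z\<in>R. fps_X * \<gamma> * fps_deriv z = w"
    if "w \<in> R" "k > 0" "\<And>j. j < k \<Longrightarrow> fps_nth w j = 0" "k \<le> Suc c" for k w
    using that(4) that(1-3)
  proof (induction k arbitrary: w rule: inc_induct)
    case base
    \<comment> \<open>The explicit solution of the differential equation, the shift being division
      by \<open>fps_X\<close>. Its order exceeds \<open>c\<close>, which places it in
      \<open>R\<close>.\<close>
    define z where "z = fps_integral0 (inverse \<gamma> * fps_shift 1 w)"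
    have "fps_nth z j = 0" if "j < c" for j
      using base(3) that by (cases j) (auto simp: z_def fps_integral_def fps_mult_nth intro!: sum.neutral)
    then have "z \<in> R" by (rule conductor)
    moreover have "fps_X * \<gamma> * fps_deriv z = (\<gamma> * inverse \<gamma>) * (fps_X * fps_shift 1 w)"
      by (simp add: z_def fps_deriv_fps_integral ac_simps)
    moreover have "fps_X * fps_shift 1 w = w" using base(3)[of 0] by (intro fps_ext) auto
    moreover have "\<gamma> * inverse \<gamma> = 1" using \<gamma> by (rule inverse_mult_eq_1')
    ultimately show ?case by (metis mult_1)
  next
    case (step k)
    \<comment> \<open>The image of \<open>w\<close> has at index \<open>k\<close> the coefficient of
      \<open>w\<close> times \<open>of_nat k * fps_nth \<gamma> 0\<close>; this factor makes the
      cancellation in \<open>w'\<close> exact.\<close>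
    define b where "b = inverse (of_nat k * fps_nth \<gamma> 0)"
    define w' where "w' = w + fps_const (-b) * (fps_X * \<gamma> * fps_deriv w)"
    have "w' \<in> R" using step.prems unfolding w'_def by (intro add scale deriv)
    moreover have "fps_nth w' j = 0" if "j < Suc k" for j
    proof -
      have "fps_nth (fps_X * \<gamma> * fps_deriv w) j = fps_nth (\<gamma> * (fps_X * fps_deriv w)) j"
        by (simp add: ac_simps)
      also have "\<dots> = (\<Sum>i=0..j. fps_nth \<gamma> i * (of_nat (j - i) * fps_nth w (j - i)))"
        unfolding fps_mult_nth[of \<gamma>] by (intro sum.cong refl) (auto simp: Suc_diff_Suc)
      \<comment> \<open>For i > 0 the index \<open>j - i\<close> lies below \<open>k\<close>, where
        \<open>w\<close> vanishes.\<close>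
      also have "\<dots> = (\<Sum>i\<in>{0}. fps_nth \<gamma> i * (of_nat (j - i) * fps_nth w (j - i)))"
        using that step.prems(3) by (intro sum.mono_neutral_right) auto
      finally have "fps_nth w' j = fps_nth w j - b * (fps_nth \<gamma> 0 * (of_nat j * fps_nth w j))"
        by (simp add: w'_def del: fps_const_neg flip: fps_const_neg)
      then show ?thesis
        using that step.prems(2,3) \<gamma> by (cases "j = k") (auto simp: b_def field_simps)
    qed
    ultimately obtain z where z: "z \<in> R" "fps_X * \<gamma> * fps_deriv z = w'"
      using step.IH[of w'] by auto
    \<comment> \<open>As \<open>w'\<close> is \<open>w\<close> minus the image of
      \<open>fps_const b * w\<close>, adding that multiple to a preimage of \<open>w'\<close> gives
      a preimage of \<open>w\<close>.\<close>
    have "fps_X * \<gamma> * fps_deriv (z + fps_const b * w) =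
        fps_X * \<gamma> * fps_deriv z + fps_const b * (fps_X * \<gamma> * fps_deriv w)"
      by (simp add: algebra_simps)
    also have "\<dots> = w"
      by (simp add: z(2) w'_def fps_const_neg[symmetric] del: fps_const_neg)
    finally have "fps_X * \<gamma> * fps_deriv (z + fps_const b * w) = w" .
    moreover have "z + fps_const b * w \<in> R" using z step.prems by (intro add scale)
    ultimately show ?case by blast
  qed
  show ?thesis using *[of w 1] w by simp
qed

lemma fps_nth_eq_0_if_less_unit_order:
  assumes "0 < k" "enat k < unit_order \<alpha>"
  shows "fps_nth \<alpha> k = 0"
proof -
  have "fps_nth (\<alpha> - fps_const (fps_nth \<alpha> 0)) k = 0"
  proof (cases "\<alpha> - fps_const (fps_nth \<alpha> 0) = 0")
    case False
    with assms(2) show ?thesis by (intro nth_less_subdegree_zero) (simp add: unit_order_def fps_val_def)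
  qed (metis fps_zero_nth)
  then show ?thesis using assms(1) by simp
qed

text \<open>The series in \<open>R\<close> without constant term form a proper ideal containing the
  generators of \<open>M\<close>, so maximality of \<open>M\<close> leaves only equality.\<close>

lemma const_term_ideal:
  fixes R :: "'k::field fps set"
  assumes R: "ring (fps_ring R)" and k: "range fps_const \<subseteq> R"
    and M: "maximalideal M (fps_ring R)" "M = Idl\<^bsub>fps_ring R\<^esub> S"
    and S: "\<And>p. p \<in> S \<Longrightarrow> p \<in> R \<and> fps_nth p 0 = 0"
  shows "M = {p \<in> R. fps_nth p 0 = 0}"
proof -
  interpret ring "fps_ring R" by fact
  let ?M0 = "{p \<in> R. fps_nth p 0 = 0}"
  have add_closed: "p + q \<in> R" and mult_closed: "p * q \<in> R" if "p \<in> R" "q \<in> R" for p q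
    using that add.m_closed[of p q] m_closed[of p q] by simp_all
  have const: "fps_const b \<in> R" for b using k by auto
  have neg: "- p \<in> R" "\<ominus>\<^bsub>fps_ring R\<^esub> p = - p" if "p \<in> R" for p
  proof -
    \<comment> \<open>Negatives come from multiplication by the constant -1, which lies in
      \<open>R\<close>.\<close>
    have "- p = fps_const (- 1) * p" by (simp add: fps_const_neg[symmetric] del: fps_const_neg)
    then show "- p \<in> R" using mult_closed[OF const that] by simp
    then show "\<ominus>\<^bsub>fps_ring R\<^esub> p = - p" using that by (intro minus_equality) auto
  qed
  have "ideal ?M0 (fps_ring R)"
  proof (rule idealI)
    show "subgroup ?M0 (add_monoid (fps_ring R))"
      using const[of 0] neg by (intro add.subgroupI) (auto intro: add_closed)
  qed (auto intro: mult_closed R)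
  moreover from this have "M \<subseteq> ?M0"
    using S unfolding M(2) genideal_def by blast
  moreover have "1 \<in> R" using one_closed by simp
  then have "?M0 \<noteq> carrier (fps_ring R)"
    by (metis (mono_tags, lifting) fps_one_nth fps_ring_simps(1) mem_Collect_eq zero_neq_one)
  ultimately show ?thesis using maximalideal.I_maximal[OF M(1), of ?M0] by auto
qed

theorem theorem1:
  fixes R :: "'k::{alg_closed_field, field_char_0} fps set"
    and M :: "'k fps set"
    and \<alpha> x :: "nat \<Rightarrow> 'k fps"
    and a :: "nat \<Rightarrow> nat"
    and n m c r :: nat
    and f :: "nat \<Rightarrow> 'k mfps"
    and I :: "'k mfps set"
  assumes "domain (fps_ring R)"
    and "noetherian_ring (fps_ring R)"
    and "local_ring (fps_ring R) M"
    and "adically_complete (fps_ring R) M"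
    and "krull_dim (fps_ring R) = 1"
    and "\<not> regular_local_ring (fps_ring R) M"
    and k_algebra: "range fps_const \<subseteq> R"
    and residue_field:
      "bij_betw (\<lambda>b. M +>\<^bsub>fps_ring R\<^esub> fps_const b) UNIV (carrier (fps_ring R Quot M))"
    and closure: "integral_closure R = range fps_to_fls"
    and conductor: "conductor R = range (\<lambda>p. fps_to_fls (fps_X ^ c * p))"
    and "n \<ge> 2"
    and "strict_mono_on {..<n} a"
    and "\<And>i. i < n \<Longrightarrow> a i > 0"
    and "\<And>i. i < n \<Longrightarrow> is_unit (\<alpha> i)"
    and "\<And>i. i < n \<Longrightarrow> x i = \<alpha> i * fps_X ^ a i"
    and "R = mfps_eval n x ` carrier (mfps_ring n)"
    and "minimal_generating_set (fps_ring R) M (x ` {..<n})"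
    and "I = a_kernel (mfps_ring n) (fps_ring R) (mfps_eval n x)"
    and "primeideal I (mfps_ring n)"
    and "I \<subseteq> ideal_power (mfps_ring n) (Idl\<^bsub>mfps_ring n\<^esub> (mfps_var ` {..<n})) 2"
    and "f ` {..<m} \<subseteq> carrier (mfps_ring n)"
    and "I = Idl\<^bsub>mfps_ring n\<^esub> (f ` {..<m})"
    and "r < n"
    and "unit_order (\<alpha> r) = Min ((\<lambda>i. unit_order (\<alpha> i)) ` {..<n})"
    and "unit_order (\<alpha> r) + enat (Min (a ` ({..<n} - {r}))) \<ge> enat c"
  shows "quasihomogeneous (fps_ring R) M (differentials R n x m f)"
proof -

  \<comment> \<open>The ring, its generators and its maximal ideal\<close>
  note conductor_bound = assms(25)
  have ring: "ring (fps_ring R)"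
    using assms(1) by (simp add: cring.axioms(1) domain.axioms(1))
  interpret ring "fps_ring R" by fact
  have add_closed: "p + q \<in> R" and mult_closed: "p * q \<in> R" if "p \<in> R" "q \<in> R" for p q
    using that add.m_closed[of p q] m_closed[of p q] by simp_all
  have const: "fps_const b \<in> R" for b using k_algebra by auto
  have zero: "0 \<in> R" using const[of 0] by simp
  have sum_closed: "sum g B \<in> R" if "finite B" "\<And>b. b \<in> B \<Longrightarrow> g b \<in> R" for g and B :: "nat set"
    using that by (induction B rule: finite_induct) (auto intro: add_closed zero)
  have x: "x i = \<alpha> i * fps_X ^ a i" and a_pos: "a i > 0" and \<alpha>: "fps_nth (\<alpha> i) 0 \<noteq> 0"
    if "i < n" for i
    using that assms(13-15) by auto
  have x0: "fps_nth (x i) 0 = 0" if "i < n" for i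
    using a_pos[OF that] by (simp add: x[OF that])
  have gen: "x ` {..<n} \<subseteq> R" "M = Idl\<^bsub>fps_ring R\<^esub> (x ` {..<n})"
    using assms(17) by (simp_all add: minimal_generating_set_def)
  have xR: "x i \<in> R" if "i < n" for i using gen that by auto
  have M: "M = {p \<in> R. fps_nth p 0 = 0}"
    using assms(3) gen x0 by (intro const_term_ideal[OF ring k_algebra _ gen(2)])
      (auto simp: local_ring_def)

  \<comment> \<open>The conductor\<close>
  have conductor_mem: "p \<in> R" if "\<And>j. j < c \<Longrightarrow> fps_nth p j = 0" for p
  proof -
    have "p = fps_X ^ c * fps_shift c p"
      using that by (intro fps_ext) (auto simp: fps_X_power_mult_nth)
    then have "fps_to_fls p \<in> conductor R" using conductor by (metis rangeI)
    \<comment> \<open>Testing a conductor element against the integral element 1 shows that it lies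
      in \<open>R\<close>.\<close>
    moreover have "1 \<in> integral_closure R" using closure by (metis fps_one_to_fls rangeI)
    ultimately have "fps_to_fls p * 1 \<in> fps_to_fls ` R" unfolding conductor_def by blast
    then show ?thesis by (auto simp: fps_to_fls_eq_iff)
  qed

  \<comment> \<open>The derivation and its values on the generators\<close>
  define \<beta> where "\<beta> i = fps_X * fps_deriv (\<alpha> i)" for i
  define u where "u i = of_nat (a i) * \<alpha> i + \<beta> i" for i
  \<comment> \<open>\<open>u i\<close> is the cofactor in
    \<open>fps_X * fps_deriv (x i) = fps_X ^ a i * u i\<close>. Hence
    \<open>fps_X * \<gamma>\<close> is the quotient of \<open>of_nat (a r) * x r\<close> by
    \<open>fps_deriv (x r)\<close>, written with the inverse of a unit only.\<close>
  define \<gamma> where "\<gamma> = of_nat (a r) * \<alpha> r * inverse (u r)"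
  define D where "D p = fps_X * \<gamma> * fps_deriv p" for p
  have r: "r < n" by fact
  \<comment> \<open>\<open>\<beta> r\<close> has no constant term, and \<open>a r\<close> stays
    nonzero in characteristic 0.\<close>
  have u0: "fps_nth (u r) 0 \<noteq> 0"
    using \<alpha>[OF r] a_pos[OF r] by (simp add: u_def \<beta>_def fps_of_nat[symmetric] del: fps_of_nat)
  have \<gamma>0: "fps_nth \<gamma> 0 \<noteq> 0"
    using \<alpha>[OF r] a_pos[OF r] u0 by (simp add: \<gamma>_def fps_of_nat[symmetric] del: fps_of_nat)
  have \<gamma>u: "\<gamma> * u r = of_nat (a r) * \<alpha> r"
    using inverse_mult_eq_1[OF u0] by (simp add: \<gamma>_def mult.assoc)
  have X_deriv_x: "fps_X * fps_deriv (x i) = fps_X ^ a i * u i" if "i < n" for i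
  proof -
    have "fps_X * (of_nat (a i) * fps_X ^ (a i - 1)) = of_nat (a i) * (fps_X ^ a i :: 'k fps)"
      using a_pos[OF that] by (cases "a i") (auto simp: algebra_simps)
    then show ?thesis
      by (simp add: x[OF that] u_def \<beta>_def fps_deriv_power fps_of_nat algebra_simps)
  qed
  \<comment> \<open>For \<open>i = r\<close> the error term vanishes, so no bound on \<open>a r\<close> is needed.\<close>
  have Dx: "D (x i) = of_nat (a i) * x i +
      inverse (u r) * (of_nat (a r) * \<alpha> r * (fps_X ^ a i * \<beta> i) - of_nat (a i) * \<alpha> i * (fps_X ^ a i * \<beta> r))"
    if "i < n" for i
  proof -
    have "D (x i) * u r = \<gamma> * u r * (fps_X * fps_deriv (x i))" by (simp add: D_def ac_simps)
    also have "\<dots> = of_nat (a r) * \<alpha> r * (fps_X ^ a i * u i)" by (simp add: \<gamma>u X_deriv_x[OF that])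
    \<comment> \<open>The product of \<open>of_nat (a r) * \<alpha> r\<close> and
      \<open>of_nat (a i) * \<alpha> i\<close> occurs on both sides and cancels, leaving only the
      cross terms with \<open>\<beta>\<close>.\<close>
    also have "\<dots> = of_nat (a i) * x i * u r +
        (of_nat (a r) * \<alpha> r * (fps_X ^ a i * \<beta> i) - of_nat (a i) * \<alpha> i * (fps_X ^ a i * \<beta> r))"
      by (simp add: u_def x[OF that] algebra_simps)
    finally have *: "D (x i) * u r = of_nat (a i) * x i * u r +
        (of_nat (a r) * \<alpha> r * (fps_X ^ a i * \<beta> i) - of_nat (a i) * \<alpha> i * (fps_X ^ a i * \<beta> r))"
      (is "_ = ?s * u r + ?E") .
    have "D (x i) = D (x i) * u r * inverse (u r)"
      using inverse_mult_eq_1'[OF u0] by (simp add: mult.assoc)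
    also have "\<dots> = ?s * (u r * inverse (u r)) + inverse (u r) * ?E"
      unfolding * distrib_right[of _ ?E] mult.commute[of ?E] by (simp only: mult.assoc)
    finally show ?thesis using inverse_mult_eq_1'[OF u0] by simp
  qed
  \<comment> \<open>\<open>\<beta> j\<close> has order at least that of \<open>\<alpha> j\<close> in
    the sense of \<open>unit_order\<close>, which is minimal at \<open>r\<close>, and
    \<open>a i\<close> is at least the minimum over indices other than \<open>r\<close>; the
    hypothesis bounds the sum of the two minima below by \<open>c\<close>. Up to index
    \<open>a i\<close> the coefficients vanish because \<open>\<beta> j\<close> has no constant
    term.\<close>
  have X\<beta>: "fps_nth (fps_X ^ a i * \<beta> j) k = 0" if ij: "i < n" "i \<noteq> r" "j < n" and k: "k < c" for i j k
  proof (cases "a i < k")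
    case True
    have "unit_order (\<alpha> r) \<le> unit_order (\<alpha> j)" unfolding assms(24) using ij by (intro Min_le) auto
    moreover have "Min (a ` ({..<n} - {r})) \<le> a i" using ij by (intro Min_le) auto
    then have "unit_order (\<alpha> r) + enat (Min (a ` ({..<n} - {r}))) \<le> unit_order (\<alpha> r) + enat (a i)"
      by (intro add_left_mono) simp
    ultimately have "enat c \<le> unit_order (\<alpha> j) + enat (a i)"
      using conductor_bound by (meson add_right_mono order_trans)
    then have "enat (k - a i) < unit_order (\<alpha> j)"
      using k True by (cases "unit_order (\<alpha> j)") auto
    with True have "fps_nth (\<alpha> j) (k - a i) = 0" by (intro fps_nth_eq_0_if_less_unit_order) auto
    then show ?thesis using True by (simp add: fps_X_power_mult_nth \<beta>_def Suc_diff_Suc)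
  qed (simp add: fps_X_power_mult_nth \<beta>_def)
  have Dx_closed: "D (x i) \<in> R" if i: "i < n" for i
  proof -
    have nat: "of_nat b * x i \<in> R" for b
      using mult_closed[OF const xR[OF i], of "of_nat b"] by (simp add: fps_of_nat)
    show ?thesis
    proof (cases "i = r")
      case True
      then show ?thesis unfolding Dx[OF i] using nat by simp
    next
      case False
      have mult0: "fps_nth (p * q) k = 0" if "\<And>j. j < c \<Longrightarrow> fps_nth q j = 0" "k < c"
        for p q :: "'k fps" and k
        using that by (simp add: fps_mult_nth)
      have "fps_nth (p * (fps_X ^ a i * \<beta> j)) k = 0" if "j < n" "k < c" for p j k
        using that by (intro mult0 X\<beta> i False)
      \<comment> \<open>The error vanishes below \<open>c\<close>, so it lies in \<open>R\<close>
        although factors such as \<open>inverse (u r)\<close> need not.\<close>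
      then show ?thesis unfolding Dx[OF i]
        by (intro add_closed nat conductor_mem mult0) (simp_all only: fps_sub_nth i r diff_self)
    qed
  qed

  \<comment> \<open>Stability of \<open>R\<close> under the derivation\<close>
  have eval_closed: "mfps_eval n x F \<in> R" if "F \<in> carrier (mfps_ring n)" for F
    using that assms(16) by auto
  have D_eval: "D (mfps_eval n x F) = (\<Sum>i<n. mfps_eval n x (mfps_deriv i F) * D (x i))" for F
    by (simp add: D_def fps_deriv_mfps_eval[OF x0] sum_distrib_left ac_simps)
  have D_closed: "D p \<in> R" if "p \<in> R" for p
  proof -
    obtain F where "F \<in> carrier (mfps_ring n)" "p = mfps_eval n x F" using \<open>p \<in> R\<close> assms(16) by auto
    then show ?thesis
      by (auto simp: D_eval intro!: sum_closed mult_closed eval_closed mfps_deriv_closed Dx_closed)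
  qed

  \<comment> \<open>The induced homomorphism and its image\<close>
  let ?A = "\<lambda>i j. mfps_eval n x (mfps_deriv i (f j))"
  let ?\<phi> = "\<lambda>v. \<Sum>i<n. v i * D (x i)"
  have f: "f j \<in> carrier (mfps_ring n)" "mfps_eval n x (f j) = 0" if "j < m" for j
  proof -
    show "f j \<in> carrier (mfps_ring n)" using assms(21) that by auto
    have "f j \<in> I" using that unfolding assms(22) genideal_def by blast
    then show "mfps_eval n x (f j) = 0" by (simp add: assms(18) a_kernel_def')
  qed
  have \<phi>_M: "?\<phi> v \<in> M" if "v \<in> {..<n} \<rightarrow>\<^sub>E R" for v
  proof -
    have "?\<phi> v \<in> R" using that by (auto intro!: sum_closed mult_closed Dx_closed simp: PiE_mem)
    \<comment> \<open>Every value of \<open>D\<close> carries the factor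
      \<open>fps_X\<close>.\<close>
    moreover have "fps_nth (?\<phi> v) 0 = 0" by (simp add: fps_sum_nth D_def)
    ultimately show ?thesis by (simp add: M)
  qed
  have surj: "?\<phi> ` ({..<n} \<rightarrow>\<^sub>E R) = M"
  proof
    show "?\<phi> ` ({..<n} \<rightarrow>\<^sub>E R) \<subseteq> M" using \<phi>_M by blast
    show "M \<subseteq> ?\<phi> ` ({..<n} \<rightarrow>\<^sub>E R)"
    proof
      fix w assume "w \<in> M"
      then have "w \<in> R" "fps_nth w 0 = 0" by (simp_all add: M)
      then have "\<exists>z\<in>R. fps_X * \<gamma> * fps_deriv z = w"
      proof (rule logarithmic_derivation_onto[rotated -2])
        show "p + q \<in> R" if "p \<in> R" "q \<in> R" for p q using that by (rule add_closed)
        show "fps_const b * p \<in> R" if "p \<in> R" for b p using const that by (rule mult_closed)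
        show "p \<in> R" if "\<And>j. j < c \<Longrightarrow> fps_nth p j = 0" for p using that by (rule conductor_mem)
        show "fps_X * \<gamma> * fps_deriv p \<in> R" if "p \<in> R" for p
          using D_closed[OF that] by (simp only: D_def)
      qed (fact \<gamma>0)
      then obtain z where z: "z \<in> R" "D z = w" unfolding D_def by blast
      then obtain F where F: "F \<in> carrier (mfps_ring n)" "D (mfps_eval n x F) = w"
        using assms(16) by blast
      show "w \<in> ?\<phi> ` ({..<n} \<rightarrow>\<^sub>E R)"
      proof
        \<comment> \<open>With \<open>w\<close> the derivative of the series \<open>F\<close>
          evaluated at the generators, the chain rule offers the evaluated partial derivatives of
          \<open>F\<close> as coefficients.\<close>
        show "w = ?\<phi> (\<lambda>i\<in>{..<n}. mfps_eval n x (mfps_deriv i F))"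
          by (simp add: F(2)[symmetric] D_eval)
      qed (intro restrict_PiE_iff[THEN iffD2] ballI eval_closed mfps_deriv_closed F)
    qed
  qed
  have "\<exists>h \<in> module_hom (fps_ring R) (matrix_coker (fps_ring R) n m ?A) (ideal_module (fps_ring R) M).
      h ` carrier (matrix_coker (fps_ring R) n m ?A) = ?\<phi> ` ({..<n} \<rightarrow>\<^sub>E R)"
  proof (rule matrix_coker_hom_exists[OF ring])
    show "?A i j \<in> R" if "j < m" for i j
      using f(1)[OF that] by (intro eval_closed mfps_deriv_closed)
    \<comment> \<open>By the chain rule this sum is \<open>D\<close> applied to the value of
      \<open>f j\<close> at the generators, which is 0.\<close>
    show "(\<Sum>i<n. ?A i j * D (x i)) = 0" if "j < m" for j
      using D_eval[of "f j"] f(2)[OF that] by (simp add: D_def)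
  qed (rule \<phi>_M)
  then show ?thesis
    unfolding quasihomogeneous_def differentials_def surj .
qed

end
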